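(* Let $T$ be an acyclic Toeplitz matrix in $\mathcal{T}_{\le 2}$. Then every connected component of the row graph $\mathrm{RG}(T)$ is a path.
   Context: Write $[m]=\{1,\dots,m\}$. For disjoint subsets $\alpha,\beta\subseteq[n-1]$, not both empty, $T_n\langle\alpha;\beta\rangle$ denotes the $n\times n$ $(0,1)$-matrix $(t_{u,v})$ with $t_{u,v}=1$ if and only if $u-v\in\alpha$ or $v-u\in\beta$; "Toeplitz matrix" here means a matrix of this form. $\mathcal{T}_{\le 2}$ is the set of such matrices with maximum row sum (computed in the integers) at most $2$. A matrix is acyclic if the digraph having it as adjacency matrix (vertex set $[n]$, arc $u\to v$ iff $t_{u,v}=1$) contains no directed cycle. The row graph $\mathrm{RG}(T)$ of an $n\times n$ $(0,1)$-matrix $T=(t_{u,v})$ is the simple graph with vertex set $[n]$ in which two distinct vertices $u,v$ are adjacent if and only if $t_{u,k}=t_{v,k}=1$ for some $k\in[n]$. An isolated vertex counts as a path (of length $0$). *)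

theory Defs
  imports "Jordan_Normal_Form.Matrix" "Graph_Theory.Graph_Theory"
begin

text \<open>
  Rows, columns and vertices are numbered \<open>0, \<dots>, n - 1\<close>, the convention of \<^typ>\<open>'a mat\<close>,
  instead of \<open>1, \<dots>, n\<close>. The entries of a Toeplitz matrix depend only on the difference of the two
  indices, so they are the same under either numbering.
\<close>

definition toeplitz :: "nat \<Rightarrow> int set \<Rightarrow> int set \<Rightarrow> int mat" where
  "toeplitz n \<alpha> \<beta> =
     mat n n (\<lambda>(u, v). if int u - int v \<in> \<alpha> \<or> int v - int u \<in> \<beta> then 1 else 0)"

definition toeplitz_mats :: "int mat set" where
  "toeplitz_mats =
     {toeplitz n \<alpha> \<beta> | n \<alpha> \<beta>. \<alpha> \<subseteq> {1..int n - 1} \<and> \<beta> \<subseteq> {1..int n - 1} \<and>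
        \<alpha> \<inter> \<beta> = {} \<and> \<not> (\<alpha> = {} \<and> \<beta> = {})}"

definition max_row_sum :: "int mat \<Rightarrow> int" where
  "max_row_sum T = Max ((\<lambda>u. \<Sum>v<dim_col T. T $$ (u, v)) ` {..<dim_row T})"

definition toeplitz_mats_le2 :: "int mat set" where
  "toeplitz_mats_le2 = {T \<in> toeplitz_mats. max_row_sum T \<le> 2}"

definition adj_digraph :: "int mat \<Rightarrow> nat pair_pre_digraph" where
  "adj_digraph T =
     \<lparr>pverts = {..<dim_row T},
      parcs = {(u, v). u < dim_row T \<and> v < dim_col T \<and> T $$ (u, v) = 1}\<rparr>"

definition acyclic_mat :: "int mat \<Rightarrow> bool" where
  "acyclic_mat T \<longleftrightarrow> \<not> (\<exists>p. pre_digraph.cycle (with_proj (adj_digraph T)) p)"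

text \<open>
  As usual in \<^theory>\<open>Graph_Theory.Digraph\<close>, a simple undirected graph is a finite loop-free symmetric
  digraph without parallel arcs; each edge is a pair of opposite arcs. The connected components of
  such a graph are its strongly connected components \<^const>\<open>pre_digraph.sccs\<close>.
\<close>

definition row_graph :: "int mat \<Rightarrow> nat pair_pre_digraph" where
  "row_graph T =
     \<lparr>pverts = {..<dim_row T},
      parcs = {(u, v). u < dim_row T \<and> v < dim_row T \<and> u \<noteq> v \<and>
                 (\<exists>k<dim_col T. T $$ (u, k) = 1 \<and> T $$ (v, k) = 1)}\<rparr>"

lemma pair_graph_row_graph: "pair_graph (row_graph T)"
proof -
  have "parcs (row_graph T) \<subseteq> {..<dim_row T} \<times> {..<dim_row T}"
    by (auto simp: row_graph_def)
  then have "finite (parcs (row_graph T))"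
    by (rule finite_subset) simp
  then show ?thesis
    by unfold_locales (auto simp: row_graph_def symmetric_def sym_def)
qed

text \<open>
  The vertices of a path are listed without repetition by \<open>xs\<close>, and its edges join consecutive
  entries of \<open>xs\<close>, and no others; a singleton \<open>xs\<close> gives the path of length \<open>0\<close>.
\<close>

definition is_path_graph :: "('a, 'b) pre_digraph \<Rightarrow> bool" where
  "is_path_graph G \<longleftrightarrow> graph G \<and>
     (\<exists>xs. xs \<noteq> [] \<and> distinct xs \<and> verts G = set xs \<and>
        arcs_ends G = (\<Union>i\<in>{i. Suc i < length xs}. {(xs ! i, xs ! Suc i), (xs ! Suc i, xs ! i)}))"

end

theory Submission
  imports Defs
begin

text \<open>
  Write \<open>T = T\<^sub>n\<langle>\<alpha>;\<beta>\<rangle>\<close>. A nonempty finite acyclic digraph has a vertex \<open>u\<close> without outgoing arcs. As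
  neither \<open>u - a\<close> nor \<open>u + b\<close> is a vertex, for \<open>a \<in> \<alpha>\<close> and \<open>b \<in> \<beta>\<close>, every such pair satisfies
  \<open>a + b > n\<close> (\<open>acyclic_toeplitz_add_gt\<close>). Hence no vertex has both a downward and an upward outgoing
  arc, nor is a vertex the head of both a downward and an upward arc: two rows that
  share a column do so either through \<open>\<alpha>\<close> alone or through \<open>\<beta>\<close> alone, and all edges of the row graph
  at a given vertex are of the same one of these two kinds.

  The first and the last row of \<open>T\<close> show that \<open>\<alpha>\<close> and \<open>\<beta>\<close> have at most two elements each
  (\<open>toeplitz_card_le\<close>). An edge of the row graph that comes from \<open>\<beta> = {b, b'}\<close> joins two vertices at
  distance exactly \<open>\<bar>b' - b\<bar>\<close>, and similarly for \<open>\<alpha>\<close>. So a vertex has at most one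
  larger and at most one smaller neighbour (\<open>toeplitz_row_graph_unique_neighbours\<close>). A cycle is
  impossible in such a graph, because its least vertex would have two larger neighbours; more
  precisely, a finite connected graph of this kind is the increasing path that starts at its least
  vertex (\<open>is_path_graph_if_unique_neighbours\<close>).
\<close>

section \<open>Graphs on a linear order\<close>

text \<open>
  A longest increasing chain of adjacent vertices from the least vertex contains all neighbours
  of its members: larger neighbours by uniqueness or by maximality of the chain, smaller ones by
  uniqueness or because the chain starts at the minimum. By connectivity it is the whole graph.
\<close>

lemma is_path_graph_if_unique_neighbours:
  fixes G :: "('a::linorder, 'b) pre_digraph"
  assumes "graph G" and conn: "strongly_connected G"
    and upper: "\<And>u v w. (u, v) \<in> arcs_ends G \<Longrightarrow> (u, w) \<in> arcs_ends G \<Longrightarrow> u < v \<Longrightarrow> u < w \<Longrightarrow> v = w"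
    and lower: "\<And>u v w. (u, v) \<in> arcs_ends G \<Longrightarrow> (u, w) \<in> arcs_ends G \<Longrightarrow> v < u \<Longrightarrow> w < u \<Longrightarrow> v = w"
  shows "is_path_graph G"
proof -
  have loc: "sym_digraph G" "fin_digraph G" "loopfree_digraph G" "wf_digraph G"
    using \<open>graph G\<close> by (auto simp: graph_def pseudo_graph_def digraph_def fin_digraph_def)
  let ?E = "arcs_ends G"
  have E_sym: "(v, u) \<in> ?E" if "(u, v) \<in> ?E" for u v
    using that sym_digraph.sym_arcs[OF loc(1)] by (auto simp: symmetric_def sym_def)
  have E_verts: "u \<in> verts G" "v \<in> verts G" if "(u, v) \<in> ?E" for u v
    using wf_digraph.adj_in_verts[OF loc(4) that] .
  have E_irrefl: "u \<noteq> v" if "(u, v) \<in> ?E" for u v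
    using that loopfree_digraph.adj_not_same[OF loc(3)] by blast
  note finite_verts = fin_digraph.finite_verts[OF loc(2)]
  have ne: "verts G \<noteq> {}"
    using conn by (auto simp: strongly_connected_def)
  define m where "m = Min (verts G)"
  have m: "m \<in> verts G" and m_le: "\<And>v. v \<in> verts G \<Longrightarrow> m \<le> v"
    using ne finite_verts by (auto simp: m_def)
  define chain where "chain xs \<longleftrightarrow> xs \<noteq> [] \<and> xs ! 0 = m \<and> set xs \<subseteq> verts G \<and>
      (\<forall>i. Suc i < length xs \<longrightarrow> xs ! i < xs ! Suc i \<and> (xs ! i, xs ! Suc i) \<in> ?E)" for xs
  have chain_distinct: "distinct xs" if "chain xs" for xs
  proof -
    have "sorted_wrt (<) xs"
      using that by (simp add: chain_def sorted_wrt_iff_nth_Suc_transp)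
    then show ?thesis
      by (simp add: strict_sorted_iff)
  qed
  have "chain [m]"
    using m by (simp add: chain_def)
  moreover have "length xs < Suc (card (verts G))" if "chain xs" for xs
    using chain_distinct[OF that] that card_mono[OF finite_verts, of "set xs"]
    by (auto simp: chain_def distinct_card)
  ultimately obtain xs where xs: "chain xs" and longest: "\<And>ys. chain ys \<Longrightarrow> length ys \<le> length xs"
    using ex_has_greatest_nat[of chain "[m]" length "Suc (card (verts G))"] by auto
  have step: "xs ! i < xs ! Suc i" "(xs ! i, xs ! Suc i) \<in> ?E" if "Suc i < length xs" for i
    using xs that by (auto simp: chain_def)
  have succ: "Suc i < length xs \<and> w = xs ! Suc i"
    if i: "i < length xs" and w: "(xs ! i, w) \<in> ?E" "xs ! i < w" for i w
  proof (cases "Suc i < length xs")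
    case True
    then show ?thesis
      using upper[OF w(1) step(2)[OF True] w(2) step(1)[OF True]] by simp
  next
    case False
    with i have "length xs = Suc i" by simp
    then have "chain (xs @ [w])"
      using xs w E_verts by (auto simp: chain_def nth_append less_Suc_eq)
    then show ?thesis
      using longest[of "xs @ [w]"] by simp
  qed
  have pred: "0 < i \<and> w = xs ! (i - 1)"
    if i: "i < length xs" and w: "(xs ! i, w) \<in> ?E" "w < xs ! i" for i w
  proof (cases i)
    case 0
    then show ?thesis
      using xs m_le[OF E_verts(2)[OF w(1)]] w(2) by (simp add: chain_def)
  next
    case (Suc j)
    then show ?thesis
      using lower[of "xs ! i" w "xs ! j"] E_sym[OF step(2)[of j]] step(1)[of j] w i by simp
  qed
  have nbr: "w \<in> set xs" if "u \<in> set xs" "(u, w) \<in> ?E" for u w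
  proof -
    obtain i where i: "i < length xs" "u = xs ! i"
      using \<open>u \<in> set xs\<close> by (auto simp: in_set_conv_nth)
    from E_irrefl[OF that(2)] consider "u < w" | "w < u" by fastforce
    then show ?thesis
      using succ[of i w] pred[of i w] i that(2) by cases (auto intro: nth_mem)
  qed
  have "v \<in> set xs" if "v \<in> verts G" for v
  proof -
    have "(m, v) \<in> ?E\<^sup>*"
      using conn m that by (auto intro: reachable_rtranclI)
    then show ?thesis
    proof (induction rule: rtrancl_induct)
      case base
      then show ?case
        using xs by (auto simp: chain_def intro: nth_mem[of 0 xs, simplified])
    next
      case (step x y)
      then show ?case
        using nbr by auto
    qed
  qed
  then have verts: "verts G = set xs"
    using xs by (auto simp: chain_def)
  have "?E = (\<Union>i\<in>{i. Suc i < length xs}. {(xs ! i, xs ! Suc i), (xs ! Suc i, xs ! i)})"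
    (is "_ = ?R")
  proof (intro equalityI subsetI)
    fix e assume e: "e \<in> ?E"
    obtain u w where uw: "e = (u, w)" by (cases e)
    then obtain i where i: "i < length xs" "u = xs ! i"
      using e E_verts verts by (auto simp: in_set_conv_nth)
    from E_irrefl[of u w] e uw consider "u < w" | "w < u" by fastforce
    then show "e \<in> ?R"
    proof cases
      case 1
      then show ?thesis using succ[of i w] i e uw by auto
    next
      case 2
      then have "0 < i" "w = xs ! (i - 1)"
        using pred[of i w] i e uw by auto
      then show ?thesis using i uw by (auto intro!: exI[of _ "i - 1"])
    qed
  qed (use step E_sym in auto)
  then show ?thesis
    using \<open>graph G\<close> verts chain_distinct[OF xs] xs by (auto simp: is_path_graph_def chain_def)
qed

lemma graph_induced_subgraph:
  assumes "graph G" and "induced_subgraph H G"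
  shows "graph H"
proof -
  have "digraph G" "sym_digraph G"
    using assms(1) by (auto simp: graph_def pseudo_graph_def)
  then have "digraph H" "sym_digraph H"
    using digraph.digraphI_induced sym_digraph.induced_graph_imp_graph assms(2) by blast+
  then show ?thesis
    by (simp add: graph_def pseudo_graph_def digraph_def)
qed

section \<open>Acyclic Toeplitz matrices\<close>

lemma acyclic_mat_ex_zero_row:
  assumes "acyclic_mat T" and "0 < dim_row T" and "dim_col T = dim_row T"
  shows "\<exists>u<dim_row T. \<forall>v<dim_col T. T $$ (u, v) \<noteq> 1"
proof -
  let ?G = "adj_digraph T"
  have sub: "parcs ?G \<subseteq> {..<dim_row T} \<times> {..<dim_row T}"
    using assms(3) by (auto simp: adj_digraph_def)
  have wfd: "wf_digraph (with_proj ?G)"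
    using sub by (auto simp: wf_digraph_def adj_digraph_def)
  have "acyclic (parcs ?G)"
  proof (rule acyclicI, intro allI notI)
    fix u assume "(u, u) \<in> (parcs ?G)\<^sup>+"
    then obtain p where "pre_digraph.awalk (with_proj ?G) u p u" "p \<noteq> []"
      using wf_digraph.reachable1_awalk[OF wfd, of u u] by auto
    then have "\<exists>p. pre_digraph.cycle (with_proj ?G) p"
      by (intro wf_digraph.closed_w_imp_cycle[OF wfd, of p]) (auto simp: wf_digraph.closed_w_def[OF wfd])
    then show False
      using assms(1) by (simp add: acyclic_mat_def)
  qed
  moreover have "finite (parcs ?G)"
    using sub by (rule finite_subset) simp
  ultimately have "wf ((parcs ?G)\<inverse>)"
    by (rule finite_acyclic_wf_converse[rotated])
  then obtain u where "u \<in> {..<dim_row T}" "\<And>v. (v, u) \<in> (parcs ?G)\<inverse> \<Longrightarrow> v \<notin> {..<dim_row T}"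
    using assms(2) wfE_min'[of "(parcs ?G)\<inverse>" "{..<dim_row T}"] by auto
  then show ?thesis
    using assms(3) by (force simp: adj_digraph_def)
qed

lemma toeplitz_dim [simp]: "dim_row (toeplitz n \<alpha> \<beta>) = n" "dim_col (toeplitz n \<alpha> \<beta>) = n"
  by (simp_all add: toeplitz_def)

lemma toeplitz_entry [simp]:
  "u < n \<Longrightarrow> v < n \<Longrightarrow> toeplitz n \<alpha> \<beta> $$ (u, v) =
    (if int u - int v \<in> \<alpha> \<or> int v - int u \<in> \<beta> then 1 else 0)"
  by (simp add: toeplitz_def)

text \<open>
  In a row \<open>u\<close> without ones, \<open>a \<in> \<alpha>\<close> forces \<open>u < a\<close> and \<open>b \<in> \<beta>\<close> forces \<open>u + b \<ge> n\<close>.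
\<close>

lemma acyclic_toeplitz_add_gt:
  assumes "acyclic_mat (toeplitz n \<alpha> \<beta>)" and "\<alpha> \<subseteq> {1..int n - 1}" and "\<beta> \<subseteq> {1..int n - 1}"
    and "a \<in> \<alpha>" and "b \<in> \<beta>"
  shows "int n < a + b"
proof -
  have "0 < n"
    using assms by (cases n) auto
  then obtain u where u: "u < n" "\<forall>v<n. toeplitz n \<alpha> \<beta> $$ (u, v) \<noteq> 1"
    using acyclic_mat_ex_zero_row[OF assms(1)] by auto
  have "int u < a"
  proof (rule ccontr)
    assume "\<not> int u < a"
    moreover have "1 \<le> a" using assms by auto
    ultimately show False
      using u(1) u(2)[rule_format, of "nat (int u - a)"] \<open>a \<in> \<alpha>\<close> by (simp add: nat_less_iff)
  qed
  moreover have "int n \<le> int u + b"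
  proof (rule ccontr)
    assume "\<not> int n \<le> int u + b"
    moreover have "1 \<le> b" using assms by auto
    ultimately show False
      using u(1) u(2)[rule_format, of "nat (int u + b)"] \<open>b \<in> \<beta>\<close> by (simp add: nat_less_iff)
  qed
  ultimately show ?thesis by simp
qed

lemma toeplitz_row_card_le:
  assumes "max_row_sum (toeplitz n \<alpha> \<beta>) \<le> c" and "u < n"
  shows "int (card {v. v < n \<and> (int u - int v \<in> \<alpha> \<or> int v - int u \<in> \<beta>)}) \<le> c"
proof -
  let ?T = "toeplitz n \<alpha> \<beta>"
  have "(\<Sum>v<n. ?T $$ (u, v)) \<le> max_row_sum ?T"
    using assms(2) by (auto simp: max_row_sum_def)
  moreover have "(\<Sum>v<n. ?T $$ (u, v)) =
      (\<Sum>v<n. if int u - int v \<in> \<alpha> \<or> int v - int u \<in> \<beta> then 1 else 0)"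
    using assms(2) by (intro sum.cong) auto
  moreover have "\<dots> = int (card {v. v < n \<and> (int u - int v \<in> \<alpha> \<or> int v - int u \<in> \<beta>)})"
    by (simp add: sum.If_cases Int_def)
  ultimately show ?thesis
    using assms(1) by linarith
qed

text \<open>
  The ones in row \<open>0\<close> correspond to the elements of \<open>\<beta>\<close>, and those in row \<open>n - 1\<close> to the elements
  of \<open>\<alpha>\<close>.
\<close>

lemma toeplitz_card_le:
  assumes "max_row_sum (toeplitz n \<alpha> \<beta>) \<le> int c"
    and "\<alpha> \<subseteq> {1..int n - 1}" and "\<beta> \<subseteq> {1..int n - 1}" and "0 < n"
  shows "card \<alpha> \<le> c" and "card \<beta> \<le> c"
proof -
  let ?R = "\<lambda>u. {v. v < n \<and> (int u - int v \<in> \<alpha> \<or> int v - int u \<in> \<beta>)}"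
  have fin: "finite (?R u)" for u by simp
  have "\<beta> \<subseteq> int ` ?R 0"
  proof
    fix b assume "b \<in> \<beta>"
    then show "b \<in> int ` ?R 0"
      using assms(3) by (intro image_eqI[of _ _ "nat b"]) (auto simp: nat_less_iff)
  qed
  then have "card \<beta> \<le> card (?R 0)"
    by (rule surj_card_le[OF fin])
  then show "card \<beta> \<le> c"
    using toeplitz_row_card_le[OF assms(1,4)] by linarith
  have "\<alpha> \<subseteq> (\<lambda>v. int (n - 1) - int v) ` ?R (n - 1)"
  proof
    fix a assume "a \<in> \<alpha>"
    then show "a \<in> (\<lambda>v. int (n - 1) - int v) ` ?R (n - 1)"
      using assms(2,4) by (intro image_eqI[of _ _ "nat (int (n - 1) - a)"]) auto
  qed
  then have "card \<alpha> \<le> card (?R (n - 1))"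
    by (rule surj_card_le[OF fin])
  then show "card \<alpha> \<le> c"
    using toeplitz_row_card_le[OF assms(1), of "n - 1"] assms(4) by linarith
qed

section \<open>Neighbours in the row graph\<close>

lemma card_le_2_diff_unique:
  fixes B :: "int set"
  assumes "finite B" "card B \<le> 2" and "b \<in> B" "b' \<in> B" "c \<in> B" "c' \<in> B"
    and "b < b' \<and> c < c' \<or> b' < b \<and> c' < c"
  shows "b' - b = c' - c"
proof -
  have "{b, b'} = B" "{c, c'} = B"
    by (rule card_seteq; use assms in auto)+
  then have "b = c \<and> b' = c' \<or> b = c' \<and> b' = c"
    by (metis doubleton_eq_iff)
  then show ?thesis
    using assms(7) by auto
qed

text \<open>
  If row \<open>u\<close> met the common column \<open>k\<close> through \<open>a \<in> \<alpha>\<close> and row \<open>v\<close> through \<open>b \<in> \<beta>\<close>, then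
  \<open>a + b = u - v < n\<close>. The bounds in the two cases record that \<open>k\<close> is a valid
  index; they keep edges of different kinds from sharing an endpoint.
\<close>

lemma toeplitz_row_graph_edge_cases:
  assumes "\<forall>a\<in>\<alpha>. \<forall>b\<in>\<beta>. int n < a + b"
    and "(u, v) \<in> parcs (row_graph (toeplitz n \<alpha> \<beta>))"
  obtains (upper) b b' where "b \<in> \<beta>" "b' \<in> \<beta>" "int v - int u = b' - b"
      "int u + b' < int n" "int v + b < int n"
  | (lower) a a' where "a \<in> \<alpha>" "a' \<in> \<alpha>" "int v - int u = a' - a" "a \<le> int u" "a' \<le> int v"
proof -
  obtain k where k: "u < n" "v < n" "k < n" "int u - int k \<in> \<alpha> \<or> int k - int u \<in> \<beta>"
      "int v - int k \<in> \<alpha> \<or> int k - int v \<in> \<beta>"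
    using assms(2) by (auto simp: row_graph_def split: if_splits)
  have "False" if "int u - int k \<in> \<alpha>" "int k - int v \<in> \<beta>"
    using assms(1)[rule_format, OF that] k by linarith
  moreover have "False" if "int v - int k \<in> \<alpha>" "int k - int u \<in> \<beta>"
    using assms(1)[rule_format, OF that] k by linarith
  ultimately consider "int k - int u \<in> \<beta>" "int k - int v \<in> \<beta>" | "int u - int k \<in> \<alpha>" "int v - int k \<in> \<alpha>"
    using k by blast
  then show thesis
  proof cases
    case 1
    then show thesis
      using k by (intro upper[of "int k - int v" "int k - int u"]) auto
  next
    case 2
    then show thesis
      by (intro lower[of "int u - int k" "int v - int k"]) auto
  qed
qed

text \<open>
  Two edges at \<open>u\<close> are of the same kind: otherwise \<open>a \<le> u\<close> and \<open>u + b < n\<close> for some \<open>a \<in> \<alpha>\<close> and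
  \<open>b \<in> \<beta>\<close>. Their lengths are then differences of two distinct elements of the same set, which has
  at most two elements, so the lengths agree.
\<close>

lemma toeplitz_row_graph_unique_neighbours:
  assumes sum: "\<forall>a\<in>\<alpha>. \<forall>b\<in>\<beta>. int n < a + b"
    and fin: "finite \<alpha>" "finite \<beta>" and card: "card \<alpha> \<le> 2" "card \<beta> \<le> 2"
    and v: "(u, v) \<in> parcs (row_graph (toeplitz n \<alpha> \<beta>))"
    and w: "(u, w) \<in> parcs (row_graph (toeplitz n \<alpha> \<beta>))"
    and side: "u < v \<and> u < w \<or> v < u \<and> w < u"
  shows "v = w"
  using sum v
proof (cases rule: toeplitz_row_graph_edge_cases)
  case (upper b b')
  note vb = this
  show ?thesis using sum w
  proof (cases rule: toeplitz_row_graph_edge_cases)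
    case (upper c c')
    have "b < b' \<and> c < c' \<or> b' < b \<and> c' < c"
      using side vb(3) upper(3) by auto
    then have "b' - b = c' - c"
      by (rule card_le_2_diff_unique[OF fin(2) card(2) vb(1,2) upper(1,2)])
    then show ?thesis
      using vb(3) upper(3) by simp
  next
    case (lower a a')
    then show ?thesis using vb sum[rule_format, of a b'] by linarith
  qed
next
  case (lower b b')
  note vb = this
  show ?thesis using sum w
  proof (cases rule: toeplitz_row_graph_edge_cases)
    case (lower c c')
    have "b < b' \<and> c < c' \<or> b' < b \<and> c' < c"
      using side vb(3) lower(3) by auto
    then have "b' - b = c' - c"
      by (rule card_le_2_diff_unique[OF fin(1) card(1) vb(1,2) lower(1,2)])
    then show ?thesis
      using vb(3) lower(3) by simp
  next
    case (upper a a')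
    then show ?thesis using vb sum[rule_format, of b a'] by linarith
  qed
qed

lemma graph_row_graph: "graph (with_proj (row_graph T))"
proof -
  interpret pair_graph "row_graph T"
    by (rule pair_graph_row_graph)
  show ?thesis
    by unfold_locales
qed

theorem proposition3p3:
  fixes T :: "int mat"
  assumes "T \<in> toeplitz_mats_le2" and "acyclic_mat T"
  shows "\<forall>C \<in> pre_digraph.sccs (with_proj (row_graph T)). is_path_graph C"
proof
  fix C assume "C \<in> pre_digraph.sccs (with_proj (row_graph T))"
  then have ind: "induced_subgraph C (with_proj (row_graph T))" and conn: "strongly_connected C"
    by (auto simp: pre_digraph.sccs_def)
  obtain n \<alpha> \<beta> where T: "T = toeplitz n \<alpha> \<beta>" and sub: "\<alpha> \<subseteq> {1..int n - 1}" "\<beta> \<subseteq> {1..int n - 1}"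
    and ne: "\<alpha> \<noteq> {} \<or> \<beta> \<noteq> {}" and sum: "max_row_sum T \<le> 2"
    using assms(1) by (auto simp: toeplitz_mats_le2_def toeplitz_mats_def)
  have "0 < n"
    using sub ne by (cases n) auto
  then have card: "card \<alpha> \<le> 2" "card \<beta> \<le> 2"
    using toeplitz_card_le[of n \<alpha> \<beta> 2] sum sub by (auto simp: T)
  have fin: "finite \<alpha>" "finite \<beta>"
    using sub by (auto intro: finite_subset)
  have unique: "v = w" if "(u, v) \<in> parcs (row_graph T)" "(u, w) \<in> parcs (row_graph T)"
      "u < v \<and> u < w \<or> v < u \<and> w < u" for u v w
    using toeplitz_row_graph_unique_neighbours[OF _ fin card, of n u v w] that
      acyclic_toeplitz_add_gt[of n \<alpha> \<beta>] assms(2) sub by (auto simp: T)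
  have "graph C"
    using graph_row_graph ind by (rule graph_induced_subgraph)
  moreover have "arcs_ends C \<subseteq> parcs (row_graph T)"
    using arcs_ends_mono[OF induced_imp_subgraph[OF ind]] by simp
  ultimately show "is_path_graph C"
    using conn by (intro is_path_graph_if_unique_neighbours) (blast dest: unique)+
qed

end
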